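(* Let $n\ge 2$ and let $G=(\mathbb{Z}^n,w)$ be an asymptotically flat grid graph with scalar curvature $R(x)\ge 0$ for all $x\in\mathbb{Z}^n$. Then $E(G)\ge 0$. Furthermore, $E(G)=0$ if and only if $G$ is the standard grid graph, i.e. $w\equiv 1$.
   Context: **Weighted graphs.** A weighted graph $G=(V,E,w)$ is a locally finite, simple, undirected, connected graph $(V,E)$ with positive symmetric edge weights $w:E\to(0,\infty)$, $w(x,y)=w(y,x)$; all vertex weights are $1$. Write $x\sim y$ if $\{x,y\}\in E$; $d$ is the combinatorial graph distance (weights ignored), $B_1(x)=\{y\in V: d(x,y)\le 1\}$. The Laplacian is $\Delta f(x)=\sum_{y\sim x}w(x,y)(f(y)-f(x))$. **Curvature.** For $x\ne y$ put $\nabla_{xy}f=\frac{f(x)-f(y)}{d(x,y)}$. The Ollivier (Ricci) curvature is $\kappa(x,y)=\inf \nabla_{xy}\Delta f$, the infimum over all $f:B_1(x)\cup B_1(y)\to\mathbb{R}$ that are $1$-Lipschitz with respect to $d$ and satisfy $\nabla_{yx}f=1$. The scalar curvature is $R(x)=\sum_{y\sim x}\kappa(x,y)$. **Grid graph.** $(\mathbb{Z}^n,w)$ has vertex set $\mathbb{Z}^n$, edges $\{x,y\}$ with $\|x-y\|_1=1$, and edge weights $w$; it is standard if $w\equiv1$. Let $e_i$ be the $i$-th standard unit vector and $x_j^\pm=x\pm e_j$. Define $$\mathrm{Abs}(x)=\sum_{i\ne j}\Big(|w(x,x+e_i)-w(x_j^+,x_j^++e_i)|+|w(x,x+e_i)-w(x_j^-,x_j^-+e_i)|+|w(x,x-e_i)-w(x_j^+,x_j^+-e_i)|+|w(x,x-e_i)-w(x_j^-,x_j^--e_i)|\Big),$$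 the sum over all ordered pairs $i\neq j$ in $\{1,\dots,n\}$. **Asymptotically flat grid graph.** With $n\ge2$, $(\mathbb{Z}^n,w)$ is asymptotically flat if there is $p>n$ such that, as $|x|\to\infty$ ($|\cdot|$ the Euclidean norm), $w(x,y)=1+o(1)$ for all $y\sim x$, $\mathrm{Abs}(x)=O(|x|^{-p})$ and $|R(x)|=O(|x|^{-p})$. **Discrete ADM mass.** Let $Q_r=\{x\in\mathbb{Z}^n:\|x\|_\infty\le r\}$, $S_r=\{x\in\mathbb{Z}^n:\|x\|_\infty=r\}$, and let $\delta Q_r$ be the set of vertices outside $Q_r$ having a neighbour in $Q_r$. Let $E_r$ be the set of edges with one endpoint in $Q_r$ and the other outside $Q_r$, and $\widetilde E_r$ the set of edges with one endpoint in $\delta Q_r$ and the other in $S_{r+2}$. The discrete ADM mass (energy) is $$E(G)=\frac{1}{2^n n}\lim_{r\to\infty}\Big(\sum_{e\in E_r}w(e)-\sum_{\tau\in\widetilde E_r}w(\tau)\Big).$$ *)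

theory Defs
  imports "HOL-Analysis.Analysis" "HOL-Library.Landau_Symbols"
begin

section \<open>Weighted graphs and Ollivier curvature\<close>

text \<open>
  A graph is given by its adjacency relation on a type of vertices, and edge weights by a binary
  function, of which only the values on adjacent pairs are ever used.
\<close>

definition weighted_graph :: "('v \<Rightarrow> 'v \<Rightarrow> bool) \<Rightarrow> ('v \<Rightarrow> 'v \<Rightarrow> real) \<Rightarrow> bool" where
  "weighted_graph adj w \<longleftrightarrow>
     irreflp adj \<and> symp adj \<and>
     (\<forall>x. finite {y. adj x y}) \<and>
     (\<forall>x y. adj\<^sup>*\<^sup>* x y) \<and>
     (\<forall>x y. adj x y \<longrightarrow> w x y > 0 \<and> w x y = w y x)"

text \<open>The minimum below is over a nonempty set, since weighted graphs are connected.\<close>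

definition graph_dist :: "('v \<Rightarrow> 'v \<Rightarrow> bool) \<Rightarrow> 'v \<Rightarrow> 'v \<Rightarrow> nat" where
  "graph_dist adj x y = (LEAST k. (adj ^^ k) x y)"

definition unit_ball :: "('v \<Rightarrow> 'v \<Rightarrow> bool) \<Rightarrow> 'v \<Rightarrow> 'v set" where
  "unit_ball adj x = {y. graph_dist adj x y \<le> 1}"

definition laplacian ::
  "('v \<Rightarrow> 'v \<Rightarrow> bool) \<Rightarrow> ('v \<Rightarrow> 'v \<Rightarrow> real) \<Rightarrow> ('v \<Rightarrow> real) \<Rightarrow> 'v \<Rightarrow> real" where
  "laplacian adj w f x = (\<Sum>y | adj x y. w x y * (f y - f x))"

definition gradient :: "('v \<Rightarrow> 'v \<Rightarrow> bool) \<Rightarrow> 'v \<Rightarrow> 'v \<Rightarrow> ('v \<Rightarrow> real) \<Rightarrow> real" where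
  "gradient adj x y f = (f x - f y) / real (graph_dist adj x y)"

definition one_lipschitz_on ::
  "('v \<Rightarrow> 'v \<Rightarrow> bool) \<Rightarrow> 'v set \<Rightarrow> ('v \<Rightarrow> real) \<Rightarrow> bool" where
  "one_lipschitz_on adj S f \<longleftrightarrow> (\<forall>u\<in>S. \<forall>v\<in>S. \<bar>f u - f v\<bar> \<le> real (graph_dist adj u v))"

text \<open>
  The test functions are total, but are constrained only on the union of the two unit balls; the
  Laplacian at \<open>x\<close> and \<open>y\<close> does not depend on the values elsewhere.  For \<open>x \<noteq> y\<close> in a weighted
  graph the set is nonempty (take the distance from \<open>x\<close>) and bounded below, so the real
  infimum is the genuine one.
\<close>

definition ollivier_curvature ::
  "('v \<Rightarrow> 'v \<Rightarrow> bool) \<Rightarrow> ('v \<Rightarrow> 'v \<Rightarrow> real) \<Rightarrow> 'v \<Rightarrow> 'v \<Rightarrow> real" where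
  "ollivier_curvature adj w x y =
     Inf {gradient adj x y (laplacian adj w f) | f.
            one_lipschitz_on adj (unit_ball adj x \<union> unit_ball adj y) f \<and> gradient adj y x f = 1}"

definition scalar_curvature ::
  "('v \<Rightarrow> 'v \<Rightarrow> bool) \<Rightarrow> ('v \<Rightarrow> 'v \<Rightarrow> real) \<Rightarrow> 'v \<Rightarrow> real" where
  "scalar_curvature adj w x = (\<Sum>y | adj x y. ollivier_curvature adj w x y)"

section \<open>Grid graphs\<close>

text \<open>The lattice of dimension \<open>n = CARD('n)\<close> is the type \<open>int ^ 'n\<close>.\<close>

definition grid_adj :: "int ^ 'n \<Rightarrow> int ^ 'n \<Rightarrow> bool" where
  "grid_adj x y \<longleftrightarrow> (\<Sum>i\<in>UNIV. \<bar>x $ i - y $ i\<bar>) = 1"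

definition euclid_norm :: "int ^ 'n \<Rightarrow> real" where
  "euclid_norm x = norm (\<chi> i. real_of_int (x $ i))"

definition max_norm :: "int ^ 'n \<Rightarrow> int" where
  "max_norm x = Max (range (\<lambda>i. \<bar>x $ i\<bar>))"

definition standard_grid :: "(int ^ 'n \<Rightarrow> int ^ 'n \<Rightarrow> real) \<Rightarrow> bool" where
  "standard_grid w \<longleftrightarrow> (\<forall>x y. grid_adj x y \<longrightarrow> w x y = 1)"

definition Abs_grid :: "(int ^ 'n \<Rightarrow> int ^ 'n \<Rightarrow> real) \<Rightarrow> int ^ 'n \<Rightarrow> real" where
  "Abs_grid w x = (\<Sum>(i, j) \<in> {(i, j). i \<noteq> j}.
     let ei = axis i 1; xp = x + axis j 1; xm = x - axis j 1 in
       \<bar>w x (x + ei) - w xp (xp + ei)\<bar> + \<bar>w x (x + ei) - w xm (xm + ei)\<bar> +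
       \<bar>w x (x - ei) - w xp (xp - ei)\<bar> + \<bar>w x (x - ei) - w xm (xm - ei)\<bar>)"

definition grid_infinity :: "(int ^ 'n) filter" where
  "grid_infinity = filtercomap euclid_norm at_top"

definition asymptotically_flat :: "(int ^ 'n \<Rightarrow> int ^ 'n \<Rightarrow> real) \<Rightarrow> bool" where
  "asymptotically_flat w \<longleftrightarrow>
     (\<exists>p > real CARD('n).
        (\<forall>\<epsilon> > 0. \<forall>\<^sub>F x in grid_infinity. \<forall>y. grid_adj x y \<longrightarrow> \<bar>w x y - 1\<bar> < \<epsilon>) \<and>
        Abs_grid w \<in> O[grid_infinity](\<lambda>x. euclid_norm x powr (- p)) \<and>
        scalar_curvature grid_adj w \<in> O[grid_infinity](\<lambda>x. euclid_norm x powr (- p)))"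

section \<open>Discrete ADM mass\<close>

definition cube :: "nat \<Rightarrow> (int ^ 'n) set" where
  "cube r = {x. max_norm x \<le> int r}"

definition cube_surface :: "nat \<Rightarrow> (int ^ 'n) set" where
  "cube_surface r = {x. max_norm x = int r}"

definition outer_boundary :: "(int ^ 'n) set \<Rightarrow> (int ^ 'n) set" where
  "outer_boundary A = {y. y \<notin> A \<and> (\<exists>x\<in>A. grid_adj y x)}"

text \<open>
  Edges joining two sets are represented by ordered pairs, oriented from the first set to the
  second.  Below, the two sets are always disjoint (the outer boundary of \<open>cube r\<close> lies in
  \<open>cube_surface (r + 1)\<close>), so every edge is represented by exactly one pair.
\<close>

definition edges_between :: "(int ^ 'n) set \<Rightarrow> (int ^ 'n) set \<Rightarrow> ((int ^ 'n) \<times> (int ^ 'n)) set" where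
  "edges_between A B = {(x, y). x \<in> A \<and> y \<in> B \<and> grid_adj x y}"

definition adm_difference :: "(int ^ 'n \<Rightarrow> int ^ 'n \<Rightarrow> real) \<Rightarrow> nat \<Rightarrow> real" where
  "adm_difference w r =
     (\<Sum>(x, y) \<in> edges_between (cube r) (- cube r). w x y) -
     (\<Sum>(x, y) \<in> edges_between (outer_boundary (cube r)) (cube_surface (r + 2)). w x y)"

text \<open>Meaningful only if \<open>adm_difference w\<close> converges.\<close>

definition adm_mass :: "(int ^ 'n \<Rightarrow> int ^ 'n \<Rightarrow> real) \<Rightarrow> real" where
  "adm_mass w = 1 / (2 ^ CARD('n) * real CARD('n)) * lim (adm_difference w)"

end

(*
  Testing the curvature of every edge at x against functions that are sums of one-variable
  functions gives 0 <= R(x) <= D(x) - Abs(x), where D(x) is the discrete divergence of differences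
  of w - 1.  Since p > n >= 2, summing Abs along a ray transverse to an edge direction shows
  w - 1 = O(|x|^(1 - p)) far from the origin, so the flux of D through the faces of a cube of
  radius r is O(r^(n - p)) and vanishes in the limit.  As D >= 0, this forces D = 0, hence Abs = 0,
  so w is invariant under transverse translations and equals its limit 1.  Thus the hypotheses
  already force the grid to be standard, and the mass is 0.
*)
theory Submission
  imports Defs
begin

section \<open>Neighbours and distance in the grid\<close>

lemma grid_adj_iff:
  fixes x y :: "int ^ 'n"
  shows "grid_adj x y \<longleftrightarrow> (\<exists>i. y = x + axis i 1 \<or> y = x - axis i 1)"
proof
  assume "grid_adj x y"
  then have s: "(\<Sum>i\<in>UNIV. \<bar>x $ i - y $ i\<bar>) = 1"
    by (simp add: grid_adj_def)
  then obtain i where i: "\<bar>x $ i - y $ i\<bar> \<noteq> 0"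
    using sum.not_neutral_contains_not_neutral[of "\<lambda>i. \<bar>x $ i - y $ i\<bar>" UNIV] by auto
  \<comment> \<open>Nonnegative integers with sum 1: the nonzero summand is 1 and all the others
    vanish.\<close>
  have "\<bar>x $ i - y $ i\<bar> + (\<Sum>k\<in>UNIV - {i}. \<bar>x $ k - y $ k\<bar>) = 1"
    using s by (simp add: sum.remove[of UNIV i])
  moreover have "(\<Sum>k\<in>UNIV - {i}. \<bar>x $ k - y $ k\<bar>) \<ge> 0"
    by (simp add: sum_nonneg)
  ultimately have a: "\<bar>x $ i - y $ i\<bar> = 1" and "(\<Sum>k\<in>UNIV - {i}. \<bar>x $ k - y $ k\<bar>) = 0"
    using i by linarith+
  then have "\<forall>k\<in>UNIV - {i}. \<bar>x $ k - y $ k\<bar> = 0"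
    by (subst sum_nonneg_eq_0_iff[symmetric]) auto
  then have z: "x $ k = y $ k" if "k \<noteq> i" for k
    using that by auto
  from a have "y $ i = x $ i + 1 \<or> y $ i = x $ i - 1"
    by linarith
  then have "y = x + axis i 1 \<or> y = x - axis i 1"
    using z by (auto simp: vec_eq_iff axis_def)
  then show "\<exists>i. y = x + axis i 1 \<or> y = x - axis i 1" ..
next
  assume "\<exists>i. y = x + axis i 1 \<or> y = x - axis i 1"
  then show "grid_adj x y"
    by (auto simp: grid_adj_def axis_def if_distrib[of abs] cong: if_cong)
qed

lemma sum_grid_neighbours:
  fixes x :: "int ^ 'n" and g :: "int ^ 'n \<Rightarrow> 'a::comm_monoid_add"
  shows "(\<Sum>y | grid_adj x y. g y) = (\<Sum>i\<in>UNIV. g (x + axis i 1) + g (x - axis i 1))"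
proof -
  have e: "{y. grid_adj x y} = range (\<lambda>i. x + axis i 1) \<union> range (\<lambda>i. x - axis i 1)"
    by (auto simp: grid_adj_iff)
  have "x + axis i 1 \<noteq> x - axis k 1" for i k
    by (auto simp: vec_eq_iff axis_def intro!: exI[of _ i])
  then have d: "range (\<lambda>i. x + axis i 1) \<inter> range (\<lambda>i. x - axis i 1) = {}"
    by blast
  have inj: "inj (\<lambda>i. x + axis i 1)" "inj (\<lambda>i. x - axis i 1)"
    by (auto simp: inj_def axis_eq_axis)
  have "(\<Sum>y | grid_adj x y. g y) =
      sum g (range (\<lambda>i. x + axis i 1)) + sum g (range (\<lambda>i. x - axis i 1))"
    unfolding e using d by (intro sum.union_disjoint) auto
  then show ?thesis
    by (simp only: sum.reindex[OF inj(1)] sum.reindex[OF inj(2)] sum.distrib o_def)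
qed

lemma weighted_graph_symD:
  assumes "weighted_graph adj w" "adj x y"
  shows "w x y = w y x"
  using assms by (auto simp: weighted_graph_def)

text \<open>Each step of a walk changes the l1 distance by at most 1. This turns Lipschitz bounds
  for the l1 norm into Lipschitz bounds for \<open>graph_dist\<close>. Reachability ensures that the
  \<open>LEAST\<close> in \<open>graph_dist\<close> is attained.\<close>

lemma l1_le_graph_dist:
  fixes u v :: "int ^ 'n"
  assumes "grid_adj\<^sup>*\<^sup>* u v"
  shows "(\<Sum>i\<in>UNIV. \<bar>u $ i - v $ i\<bar>) \<le> int (graph_dist grid_adj u v)"
proof -
  have r: "(grid_adj ^^ k) u v \<Longrightarrow> (\<Sum>i\<in>UNIV. \<bar>u $ i - v $ i\<bar>) \<le> int k" for k
  proof (induction k arbitrary: v)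
    case (Suc k)
    then obtain z where z: "(grid_adj ^^ k) u z" "grid_adj z v"
      by auto
    have "(\<Sum>i\<in>UNIV. \<bar>u $ i - v $ i\<bar>)
        \<le> (\<Sum>i\<in>UNIV. \<bar>u $ i - z $ i\<bar> + \<bar>z $ i - v $ i\<bar>)"
      by (intro sum_mono) linarith
    then show ?case
      using Suc.IH[OF z(1)] z(2) by (simp add: sum.distrib grid_adj_def)
  qed auto
  from assms obtain k where "(grid_adj ^^ k) u v"
    using rtranclp_imp_relpowp by metis
  then have "(grid_adj ^^ graph_dist grid_adj u v) u v"
    unfolding graph_dist_def by (rule LeastI)
  then show ?thesis by (rule r)
qed

section \<open>Upper bounds for curvature from test functions\<close>

lemma graph_dist_adj:
  assumes "adj x y" "x \<noteq> y"
  shows "graph_dist adj x y = 1"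
  unfolding graph_dist_def
proof (rule Least_equality)
  show "(adj ^^ 1) x y" using assms(1) by auto
  show "1 \<le> k" if "(adj ^^ k) x y" for k
    using that assms(2) by (cases k) auto
qed

text \<open>A Lipschitz function changes by at most 1 along an edge. The resulting bound is
  independent of \<open>f\<close>, so the set defining \<open>ollivier_curvature\<close> is bounded
  below and its real \<open>Inf\<close> is a genuine infimum.\<close>

lemma abs_laplacian_le:
  assumes wg: "weighted_graph adj w" and L: "one_lipschitz_on adj S f"
    and S: "unit_ball adj x \<subseteq> S"
  shows "\<bar>laplacian adj w f x\<bar> \<le> (\<Sum>y | adj x y. w x y)"
proof -
  have "\<bar>w x y * (f y - f x)\<bar> \<le> w x y" if "adj x y" for y
  proof -
    have "x \<noteq> y" using wg that by (auto simp: weighted_graph_def irreflp_def)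
    then have d: "graph_dist adj x y = 1"
      using that by (rule graph_dist_adj[rotated])
    have "graph_dist adj x x = 0"
      unfolding graph_dist_def by (rule Least_equality) auto
    then have "x \<in> S" "y \<in> S"
      using S d by (auto simp: unit_ball_def)
    then have "\<bar>f x - f y\<bar> \<le> 1"
      using L d unfolding one_lipschitz_on_def by fastforce
    moreover have "w x y > 0" using wg that by (auto simp: weighted_graph_def)
    ultimately show ?thesis
      by (simp add: abs_mult abs_minus_commute mult_left_le)
  qed
  then show ?thesis
    unfolding laplacian_def by (intro order_trans[OF sum_abs] sum_mono) auto
qed

lemma ollivier_curvature_le:
  assumes wg: "weighted_graph adj w" and xy: "adj x y"
    and L: "one_lipschitz_on adj (unit_ball adj x \<union> unit_ball adj y) f"
    and f: "f y - f x = 1"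
  shows "ollivier_curvature adj w x y \<le> laplacian adj w f x - laplacian adj w f y"
proof -
  have ne: "x \<noteq> y" and yx: "adj y x"
    using wg xy by (auto simp: weighted_graph_def irreflp_def dest: sympD)
  have d: "graph_dist adj x y = 1" "graph_dist adj y x = 1"
    using graph_dist_adj[of adj x y] graph_dist_adj[of adj y x] xy yx ne by auto
  let ?A = "{gradient adj x y (laplacian adj w f) | f.
            one_lipschitz_on adj (unit_ball adj x \<union> unit_ball adj y) f \<and> gradient adj y x f = 1}"
  have "bdd_below ?A"
  proof (rule bdd_belowI[of _ "- ((\<Sum>z | adj x z. w x z) + (\<Sum>z | adj y z. w y z))"])
    fix a assume "a \<in> ?A"
    then obtain h where h: "a = laplacian adj w h x - laplacian adj w h y"
        "one_lipschitz_on adj (unit_ball adj x \<union> unit_ball adj y) h"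
      using d by (auto simp: gradient_def)
    show "- ((\<Sum>z | adj x z. w x z) + (\<Sum>z | adj y z. w y z)) \<le> a"
      using abs_laplacian_le[OF wg h(2), of x] abs_laplacian_le[OF wg h(2), of y] h(1)
      by auto
  qed
  moreover have "laplacian adj w f x - laplacian adj w f y \<in> ?A"
    using L f d by (auto simp: gradient_def intro!: exI[of _ f])
  ultimately show ?thesis
    unfolding ollivier_curvature_def by (rule cInf_lower[rotated])
qed

text \<open>The test function is a sum of one-variable functions: it has slope \<open>s\<close>
  along the edge, and its transverse slopes are signs chosen so that each transverse difference of
  weights enters as minus its absolute value. The parameter \<open>s\<close> treats both
  orientations of the edge at once.\<close>

lemma grid_curvature_le:
  fixes x :: "int ^ 'n" and s :: int and i :: 'n
  assumes wg: "weighted_graph grid_adj w" and s: "s = 1 \<or> s = -1"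
  defines "y \<equiv> x + axis i s"
  shows "ollivier_curvature grid_adj w x y \<le>
    2 * w x y - w x (x - axis i s) - w y (y + axis i s) -
    (\<Sum>j\<in>UNIV - {i}. \<bar>w x (x + axis j 1) - w y (y + axis j 1)\<bar> +
                      \<bar>w x (x - axis j 1) - w y (y - axis j 1)\<bar>)"
proof -
  \<comment> \<open>\<open>a j\<close> and \<open>b j\<close> are the desired increments of the test
    function towards \<open>+ axis j 1\<close> and \<open>- axis j 1\<close>.\<close>
  define a where "a j = - sgn (w x (x + axis j 1) - w y (y + axis j 1))" for j
  define b where "b j = - sgn (w x (x - axis j 1) - w y (y - axis j 1))" for j
  have ab: "\<bar>a j\<bar> \<le> 1" "\<bar>b j\<bar> \<le> 1" for j
    by (auto simp: a_def b_def abs_sgn_eq)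
  \<comment> \<open>The kink at 0 lets the two increments be prescribed independently: the values at
    1 and -1 are \<open>a j\<close> and \<open>b j\<close>.\<close>
  define \<phi> :: "'n \<Rightarrow> int \<Rightarrow> real" where
    "\<phi> j t = (if j = i then real_of_int (s * t)
              else if t \<ge> 0 then a j * t else - b j * t)" for j t
  have phi_lip: "\<bar>\<phi> j t - \<phi> j t'\<bar> \<le> \<bar>t - t'\<bar>" for j t t'
  proof -
    have mul: "\<bar>c * u\<bar> \<le> \<bar>u\<bar>" if "\<bar>c\<bar> \<le> 1" for c u :: real
      using that by (simp add: abs_mult mult_left_le_one_le)
    consider "j = i" | "j \<noteq> i" "t \<ge> 0" "t' \<ge> 0" | "j \<noteq> i" "t < 0" "t' < 0"
      | "j \<noteq> i" "t \<ge> 0" "t' < 0" | "j \<noteq> i" "t < 0" "t' \<ge> 0" by linarith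
    then show ?thesis
    proof cases
      case 1
      then show ?thesis using s by (auto simp: \<phi>_def)
    next
      case 2
      then show ?thesis using mul[OF ab(1), of j "real_of_int (t - t')"]
        by (simp add: \<phi>_def algebra_simps)
    next
      case 3
      then show ?thesis using mul[OF ab(2), of j "real_of_int (t - t')"]
        by (simp add: \<phi>_def algebra_simps abs_minus_commute)
    next
      \<comment> \<open>On opposite sides of the kink, the distance between \<open>t\<close> and
        \<open>t'\<close> is the sum of their absolute values, so each side is bounded
        separately.\<close>
      case 4
      then show ?thesis
        using mul[OF ab(1), of j "real_of_int t"] mul[OF ab(2), of j "real_of_int t'"]
        by (simp add: \<phi>_def algebra_simps)
    next
      case 5
      then show ?thesis
        using mul[OF ab(1), of j "real_of_int t'"] mul[OF ab(2), of j "real_of_int t"]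
        by (simp add: \<phi>_def algebra_simps)
    qed
  qed
  define f where "f z = (\<Sum>j\<in>UNIV. \<phi> j (z $ j - x $ j))" for z :: "int ^ 'n"
  have lip: "one_lipschitz_on grid_adj S f" for S
    unfolding one_lipschitz_on_def
  proof (intro ballI)
    fix u v :: "int ^ 'n"
    have "\<bar>f u - f v\<bar> \<le> (\<Sum>j\<in>UNIV. \<bar>\<phi> j (u $ j - x $ j) - \<phi> j (v $ j - x $ j)\<bar>)"
      unfolding f_def sum_subtractf[symmetric] by (rule sum_abs)
    also have "\<dots> \<le> (\<Sum>j\<in>UNIV. real_of_int \<bar>u $ j - v $ j\<bar>)"
    proof (rule sum_mono)
      show "\<bar>\<phi> j (u $ j - x $ j) - \<phi> j (v $ j - x $ j)\<bar> \<le> real_of_int \<bar>u $ j - v $ j\<bar>" for j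
        using phi_lip[of j "u $ j - x $ j" "v $ j - x $ j"] by simp
    qed
    also have "\<dots> = real_of_int (\<Sum>j\<in>UNIV. \<bar>u $ j - v $ j\<bar>)"
      by simp
    also have "\<dots> \<le> real (graph_dist grid_adj u v)"
      using l1_le_graph_dist[of u v] wg unfolding weighted_graph_def
      by (metis of_int_le_iff of_int_of_nat_eq)
    finally show "\<bar>f u - f v\<bar> \<le> real (graph_dist grid_adj u v)" .
  qed
  have upd: "f (z + axis j t) - f z = \<phi> j (z $ j + t - x $ j) - \<phi> j (z $ j - x $ j)" for z j t
  proof -
    have "(\<Sum>k\<in>UNIV - {j}. \<phi> k ((z + axis j t) $ k - x $ k))
        = (\<Sum>k\<in>UNIV - {j}. \<phi> k (z $ k - x $ k))"
      by (intro sum.cong) (auto simp: axis_def)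
    then show ?thesis
      unfolding f_def by (simp add: sum.remove[of UNIV j] axis_def)
  qed
  have minus: "z - axis j 1 = z + axis j (- 1)" for z :: "int ^ 'n" and j
    by (auto simp: vec_eq_iff axis_def)
  \<comment> \<open>\<open>x\<close> and \<open>y\<close> differ only in coordinate
    \<open>i\<close>, where the function is linear. Hence the increments at both points agree, and
    the two Laplacians can be subtracted neighbour by neighbour.\<close>
  have f_step: "f (z + axis j 1) - f z = (if j = i then s else a j)"
    "f (z - axis j 1) - f z = (if j = i then - s else b j)" if "z = x \<or> z = y" for z j
    using that unfolding minus upd
    by (auto simp: \<phi>_def y_def axis_def algebra_simps)
  have xy: "grid_adj x y"
    using s by (auto simp: grid_adj_iff y_def minus)
  have "f y - f x = 1"
    using s upd[of x i s] by (auto simp: y_def \<phi>_def)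
  then have "ollivier_curvature grid_adj w x y \<le> laplacian grid_adj w f x - laplacian grid_adj w f y"
    by (intro ollivier_curvature_le[OF wg xy] lip)
  also have "\<dots> = (\<Sum>j\<in>UNIV.
      (w x (x + axis j 1) - w y (y + axis j 1)) * (if j = i then s else a j) +
      (w x (x - axis j 1) - w y (y - axis j 1)) * (if j = i then - s else b j))"
    unfolding laplacian_def sum_grid_neighbours
    by (simp add: f_step sum_subtractf[symmetric] algebra_simps)
  also have "\<dots> = (w x (x + axis i 1) - w y (y + axis i 1)) * s -
      (w x (x - axis i 1) - w y (y - axis i 1)) * s +
      (\<Sum>j\<in>UNIV - {i}. (w x (x + axis j 1) - w y (y + axis j 1)) * a j +
         (w x (x - axis j 1) - w y (y - axis j 1)) * b j)"
    by (simp add: sum.remove[of UNIV i])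
  also have "(\<Sum>j\<in>UNIV - {i}. (w x (x + axis j 1) - w y (y + axis j 1)) * a j +
         (w x (x - axis j 1) - w y (y - axis j 1)) * b j) =
      - (\<Sum>j\<in>UNIV - {i}. \<bar>w x (x + axis j 1) - w y (y + axis j 1)\<bar> +
                      \<bar>w x (x - axis j 1) - w y (y - axis j 1)\<bar>)"
    unfolding sum_negf[symmetric] by (intro sum.cong) (auto simp: a_def b_def abs_sgn)
  \<comment> \<open>The edge between \<open>x\<close> and \<open>y\<close> occurs in both
    Laplacians, which produces the factor 2.\<close>
  also have "(w x (x + axis i 1) - w y (y + axis i 1)) * s -
      (w x (x - axis i 1) - w y (y - axis i 1)) * s =
      2 * w x y - w x (x - axis i s) - w y (y + axis i s)"
  proof -
    have m: "x - axis i (- 1) = x + axis i 1" "x + axis i 1 + axis i (- 1) = x"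
      "x + axis i (- 1) + axis i 1 = x"
      by (simp_all add: vec_eq_iff axis_def)
    have "w y x = w x y"
      using weighted_graph_symD[OF wg xy] by simp
    then show ?thesis
      using s by (auto simp: y_def minus m)
  qed
  finally show ?thesis by simp
qed

text \<open>The edge bounds for \<open>axis i 1\<close> and \<open>- axis i 1\<close> are added.
  Each subtracts the opposite edge weight at \<open>x\<close> once, which reduces the coefficient 2
  to 1; the transverse terms add up to exactly \<open>Abs_grid\<close>.\<close>

lemma scalar_curvature_le:
  fixes x :: "int ^ 'n"
  assumes wg: "weighted_graph grid_adj w"
  shows "scalar_curvature grid_adj w x \<le>
    (\<Sum>i\<in>UNIV. w x (x + axis i 1) - w (x + axis i 1) (x + axis i 1 + axis i 1) +
              w x (x - axis i 1) - w (x - axis i 1) (x - axis i 1 - axis i 1)) - Abs_grid w x"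
proof -
  define h where "h i v = (let y = x + v in
      \<bar>w x (x + axis i 1) - w y (y + axis i 1)\<bar> + \<bar>w x (x - axis i 1) - w y (y - axis i 1)\<bar>)"
    for i :: 'n and v
  have m: "axis i (- 1) = (- axis i 1 :: int ^ 'n)" for i
    by (auto simp: vec_eq_iff axis_def)
  have p: "ollivier_curvature grid_adj w x (x + axis i 1) \<le> 2 * w x (x + axis i 1)
      - w x (x - axis i 1) - w (x + axis i 1) (x + axis i 1 + axis i 1)
      - (\<Sum>j\<in>UNIV - {i}. h j (axis i 1))" for i
    using grid_curvature_le[OF wg, of 1 x i] by (simp add: h_def Let_def)
  have n: "ollivier_curvature grid_adj w x (x - axis i 1) \<le> 2 * w x (x - axis i 1)
      - w x (x + axis i 1) - w (x - axis i 1) (x - axis i 1 - axis i 1)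
      - (\<Sum>j\<in>UNIV - {i}. h j (- axis i 1))" for i
    using grid_curvature_le[OF wg, of "-1" x i] by (simp add: h_def Let_def m)
  have "scalar_curvature grid_adj w x \<le>
      (\<Sum>i\<in>UNIV. (w x (x + axis i 1) - w (x + axis i 1) (x + axis i 1 + axis i 1) +
              w x (x - axis i 1) - w (x - axis i 1) (x - axis i 1 - axis i 1))
        - (\<Sum>j\<in>UNIV - {i}. h j (axis i 1) + h j (- axis i 1)))"
    unfolding scalar_curvature_def sum_grid_neighbours sum.distrib[of "\<lambda>j. h j (axis _ 1)"]
    by (rule sum_mono) (use p n in \<open>smt (verit)\<close>)
  then have "scalar_curvature grid_adj w x \<le>
      (\<Sum>i\<in>UNIV. w x (x + axis i 1) - w (x + axis i 1) (x + axis i 1 + axis i 1) +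
              w x (x - axis i 1) - w (x - axis i 1) (x - axis i 1 - axis i 1))
        - (\<Sum>i\<in>UNIV. \<Sum>j\<in>UNIV - {i}. h j (axis i 1) + h j (- axis i 1))"
    by (subst (asm) sum_subtractf)
  also have "(\<Sum>i\<in>UNIV. \<Sum>j\<in>UNIV - {i}. h j (axis i 1) + h j (- axis i 1)) =
      (\<Sum>(i, j)\<in>(SIGMA i:UNIV. UNIV - {i}). h j (axis i 1) + h j (- axis i 1))"
    by (rule sum.Sigma) auto
  \<comment> \<open>In the curvature bound \<open>i\<close> is the direction of displacement and
    \<open>j\<close> that of the compared edges; in \<open>Abs_grid\<close> the roles are
    reversed.\<close>
  also have "\<dots> = (\<Sum>(i, j) \<in> {(i, j). i \<noteq> j}. h i (axis j 1) + h i (- axis j 1))"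
    by (rule sum.reindex_bij_witness[of _ prod.swap prod.swap]) auto
  also have "\<dots> = Abs_grid w x"
    unfolding Abs_grid_def by (intro sum.cong) (auto simp: h_def Let_def)
  finally show ?thesis .
qed

section \<open>Decay of edge weights at infinity\<close>

lemma eventually_grid_infinity:
  "eventually P grid_infinity \<longleftrightarrow> (\<exists>N. \<forall>x. euclid_norm x \<ge> N \<longrightarrow> P x)"
  unfolding grid_infinity_def eventually_filtercomap eventually_at_top_linorder
  by blast

lemma component_le_euclid_norm: "real_of_int \<bar>x $ i\<bar> \<le> euclid_norm x"
  using component_le_norm_cart[of "\<chi> i. real_of_int (x $ i)" i] by (simp add: euclid_norm_def)

lemma filterlim_axis_grid_infinity:
  fixes x :: "int ^ 'n"
  assumes "s \<noteq> 0"
  shows "filterlim (\<lambda>k. x + axis j (s * int k)) grid_infinity sequentially"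
  unfolding grid_infinity_def filterlim_filtercomap_iff
proof (rule filterlim_at_top_mono)
  show "filterlim (\<lambda>k. real k - \<bar>real_of_int (x $ j)\<bar>) at_top sequentially"
    by (simp add: filterlim_tendsto_add_at_top[OF tendsto_const filterlim_real_sequentially,
          of "- \<bar>real_of_int (x $ j)\<bar>"] flip: uminus_add_conv_diff)
  have "real k - \<bar>real_of_int (x $ j)\<bar> \<le> euclid_norm (x + axis j (s * int k))" for k
  proof -
    have "int k \<le> \<bar>s * int k\<bar>"
      using assms mult_right_mono[of 1 "\<bar>s\<bar>" "int k"] by (simp add: abs_mult)
    then have "int k - \<bar>x $ j\<bar> \<le> \<bar>(x + axis j (s * int k)) $ j\<bar>"
      by (simp add: axis_def)
    then have "real k - \<bar>real_of_int (x $ j)\<bar> \<le> real_of_int \<bar>(x + axis j (s * int k)) $ j\<bar>"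
      by linarith
    then show ?thesis
      using component_le_euclid_norm[of "x + axis j (s * int k)" j] by linarith
  qed
  then show "\<forall>\<^sub>F k in sequentially. real k - \<bar>real_of_int (x $ j)\<bar>
      \<le> (euclid_norm \<circ> (\<lambda>k. x + axis j (s * int k))) k"
    by simp
qed

text \<open>The differences of \<open>g\<close> are telescoped along a ray in direction
  \<open>j\<close>, on which coordinate \<open>i\<close> keeps its size. The factor
  \<open>real m ^ q\<close> anticipates the growth of a cube face and is absorbed into the series,
  whose value is a tail that vanishes as \<open>m\<close> grows.\<close>

lemma transverse_decay:
  fixes g :: "int ^ 'n \<Rightarrow> real"
  assumes ij: "i \<noteq> j" and C: "0 \<le> C" and p: "real q + 1 < p"
    and step: "\<And>x. N \<le> euclid_norm x \<Longrightarrow> \<bar>g x - g (x + axis j 1)\<bar> \<le> C * euclid_norm x powr - p"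
      "\<And>x. N \<le> euclid_norm x \<Longrightarrow> \<bar>g x - g (x - axis j 1)\<bar> \<le> C * euclid_norm x powr - p"
    and lim: "(g \<longlongrightarrow> 0) grid_infinity"
    and m: "1 \<le> m" "N \<le> real m" "int m \<le> \<bar>x $ i\<bar>"
  shows "real m ^ q * \<bar>g x\<bar> \<le> C * 2 powr p * (\<Sum>k. real (k + m) powr (real q - p))"
proof -
  \<comment> \<open>The ray moves away from the hyperplane where coordinate \<open>j\<close> is 0,
    so after \<open>k\<close> steps this coordinate has size at least \<open>k\<close>.\<close>
  define s :: int where "s = (if x $ j \<ge> 0 then 1 else - 1)"
  define y where "y k = x + axis j (s * int k)" for k
  define b where "b k = C * 2 powr p * real (k + m) powr (real q - p)" for k
  have yk: "real k \<le> euclid_norm (y k)" for k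
  proof -
    have "int k \<le> \<bar>y k $ j\<bar>"
      by (auto simp: y_def s_def axis_def)
    then have "real k \<le> real_of_int \<bar>y k $ j\<bar>" by linarith
    then show ?thesis using component_le_euclid_norm[of "y k" j] by linarith
  qed
  have ym: "real m \<le> euclid_norm (y k)" for k
  proof -
    have "int m \<le> \<bar>y k $ i\<bar>"
      using m(3) ij by (auto simp: y_def axis_def)
    then have "real m \<le> real_of_int \<bar>y k $ i\<bar>" by linarith
    then show ?thesis using component_le_euclid_norm[of "y k" i] by linarith
  qed
  have diff: "real m ^ q * \<bar>g (y k) - g (y (Suc k))\<bar> \<le> b k" for k
  proof -
    have "y (Suc k) = y k + axis j 1 \<or> y (Suc k) = y k - axis j 1"
      by (auto simp: y_def s_def vec_eq_iff axis_def)
    then have "\<bar>g (y k) - g (y (Suc k))\<bar> \<le> C * euclid_norm (y k) powr - p"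
      using step[of "y k"] ym[of k] m(2) by auto
    \<comment> \<open>The norm is at least both \<open>k\<close> and \<open>m\<close>, hence at
      least their mean.\<close>
    also have "\<dots> \<le> C * (real (k + m) / 2) powr - p"
      using yk[of k] ym[of k] m(1) p C
      by (intro mult_left_mono powr_mono2') auto
    also have "\<dots> = C * 2 powr p * real (k + m) powr - p"
      by (simp add: powr_divide powr_minus field_simps)
    finally have "real m ^ q * \<bar>g (y k) - g (y (Suc k))\<bar> \<le>
        real (k + m) ^ q * (C * 2 powr p * real (k + m) powr - p)"
      by (intro mult_mono power_mono) auto
    also have "\<dots> = b k"
      using m(1) by (simp add: b_def powr_realpow[symmetric] powr_add[symmetric] powr_diff powr_minus field_simps)
    finally show ?thesis .
  qed
  have "summable (\<lambda>k. real k powr (real q - p))"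
    using p by (simp add: summable_real_powr_iff)
  then have s0: "summable (\<lambda>k. real (k + m) powr (real q - p))"
    by (rule summable_ignore_initial_segment)
  then have sb: "summable b"
    unfolding b_def by (rule summable_mult)
  have "real m ^ q * \<bar>g x\<bar> \<le> suminf b + real m ^ q * \<bar>g (y K)\<bar>" for K
  proof -
    have "real m ^ q * \<bar>g x\<bar> \<le> (\<Sum>k<K. b k) + real m ^ q * \<bar>g (y K)\<bar>"
    proof (induction K)
      case 0
      have "y 0 = x" by (simp add: y_def vec_eq_iff axis_def)
      then show ?case by simp
    next
      case (Suc K)
      have "real m ^ q * \<bar>g (y K)\<bar> \<le>
          real m ^ q * (\<bar>g (y K) - g (y (Suc K))\<bar> + \<bar>g (y (Suc K))\<bar>)"
        by (intro mult_left_mono) auto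
      then show ?case using Suc diff[of K] by (simp add: algebra_simps)
    qed
    also have "(\<Sum>k<K. b k) \<le> suminf b"
    proof (rule sum_le_suminf[OF sb])
      show "0 \<le> b k" for k using C by (simp add: b_def)
    qed simp
    finally show ?thesis by simp
  qed
  moreover have "(\<lambda>K. suminf b + real m ^ q * \<bar>g (y K)\<bar>) \<longlonglongrightarrow> suminf b + real m ^ q * \<bar>0\<bar>"
    unfolding y_def
    by (intro tendsto_intros filterlim_compose[OF lim] filterlim_axis_grid_infinity)
      (simp add: s_def)
  ultimately have "real m ^ q * \<bar>g x\<bar> \<le> suminf b + real m ^ q * \<bar>0\<bar>"
    by (intro LIMSEQ_le_const) auto
  also have "suminf b = C * 2 powr p * (\<Sum>k. real (k + m) powr (real q - p))"
    unfolding b_def using s0 by (rule suminf_mult)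
  finally show ?thesis by simp
qed

section \<open>Cubes, their faces and telescoping sums\<close>

lemma mem_cube_iff: "x \<in> cube r \<longleftrightarrow> (\<forall>i. \<bar>x $ i\<bar> \<le> int r)"
  by (auto simp: cube_def max_norm_def)

lemma mem_cube_surface_iff:
  "x \<in> cube_surface r \<longleftrightarrow> (\<forall>i. \<bar>x $ i\<bar> \<le> int r) \<and> (\<exists>i. \<bar>x $ i\<bar> = int r)"
proof -
  have "x \<in> cube_surface r \<longleftrightarrow> Max (range (\<lambda>i. \<bar>x $ i\<bar>)) = int r"
    by (simp add: cube_surface_def max_norm_def)
  also have "\<dots> \<longleftrightarrow> int r \<in> range (\<lambda>i. \<bar>x $ i\<bar>) \<and> (\<forall>a\<in>range (\<lambda>i. \<bar>x $ i\<bar>). a \<le> int r)"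
    by (rule Max_eq_iff) auto
  finally show ?thesis by (auto simp: image_iff eq_commute)
qed

text \<open>Forgetting coordinate \<open>i\<close> embeds the slice into a product of intervals with
  \<open>2 * r + 1\<close> points each. The height \<open>c\<close> is arbitrary, so that the layer
  just outside the cube is covered too.\<close>

lemma finite_cube_slice:
  fixes i :: "'n::finite"
  defines "F r c \<equiv> {x :: int ^ 'n. x $ i = c \<and> (\<forall>j. j \<noteq> i \<longrightarrow> \<bar>x $ j\<bar> \<le> int r)}"
  shows "finite (F r c)" "card (F r c) \<le> (2 * r + 1) ^ (CARD('n) - 1)"
proof -
  define h where "h x = restrict (($) x) (UNIV - {i})" for x :: "int ^ 'n"
  let ?P = "PiE (UNIV - {i}) (\<lambda>_. {- int r..int r})"
  have inj: "inj_on h (F r c)"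
  proof (rule inj_onI)
    fix x y assume *: "x \<in> F r c" "y \<in> F r c" "h x = h y"
    have "x $ j = y $ j" for j
    proof (cases "j = i")
      case False
      then show ?thesis using fun_cong[OF *(3), of j] by (simp add: h_def)
    qed (use * in \<open>simp add: F_def\<close>)
    then show "x = y" by (simp add: vec_eq_iff)
  qed
  have img: "h ` F r c \<subseteq> ?P"
  proof (rule image_subsetI, rule PiE_I)
    fix x j assume "x \<in> F r c" "j \<in> UNIV - {i}"
    then have "\<bar>x $ j\<bar> \<le> int r" by (simp add: F_def)
    then show "h x j \<in> {- int r..int r}" using \<open>j \<in> UNIV - {i}\<close> by (simp add: h_def abs_le_iff)
  qed (simp add: h_def)
  have fP: "finite ?P" by (intro finite_PiE) auto
  show "finite (F r c)"
    using inj img fP by (metis finite_imageD finite_subset)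
  have "card (F r c) \<le> card ?P"
    using inj img fP by (rule card_inj_on_le)
  also have "\<dots> = (2 * r + 1) ^ (CARD('n) - 1)"
    by (simp add: card_PiE card_Diff_singleton nat_add_distrib nat_mult_distrib)
  finally show "card (F r c) \<le> (2 * r + 1) ^ (CARD('n) - 1)" .
qed

lemma finite_cube: "finite (cube r :: (int ^ 'n) set)"
proof -
  fix i :: 'n
  have "cube r \<subseteq> (\<Union>c\<in>{- int r..int r}. {x :: int ^ 'n. x $ i = c \<and> (\<forall>j. j \<noteq> i \<longrightarrow> \<bar>x $ j\<bar> \<le> int r)})"
    by (auto simp: mem_cube_iff abs_le_iff) (metis minus_le_iff)
  then show ?thesis
    by (rule finite_subset) (intro finite_UN_I finite_cube_slice; simp)
qed

text \<open>A one-directional discrete divergence theorem: the cube and its shift by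
  \<open>axis i 1\<close> cancel on their overlap, leaving one layer at each end.\<close>

lemma abs_sum_cube_telescope_le:
  fixes k :: "int ^ 'n \<Rightarrow> real"
  assumes B: "\<And>x. x $ i = - int r \<or> x $ i = int r + 1 \<Longrightarrow> \<bar>k x\<bar> \<le> B" and "0 \<le> B"
  shows "\<bar>\<Sum>x\<in>cube r. k x - k (x + axis i 1)\<bar> \<le> 2 * real (2 * r + 1) ^ (CARD('n) - 1) * B"
proof -
  let ?Q = "cube r :: (int ^ 'n) set" and ?S = "(\<lambda>x. x + axis i 1) ` cube r"
  let ?F = "\<lambda>c. {x :: int ^ 'n. x $ i = c \<and> (\<forall>j. j \<noteq> i \<longrightarrow> \<bar>x $ j\<bar> \<le> int r)}"
  have fin: "finite ?Q" "finite ?S" by (simp_all add: finite_cube)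
  have S: "x \<in> ?S \<longleftrightarrow> x - axis i 1 \<in> ?Q" for x
    by (metis (no_types, lifting) add_diff_cancel diff_add_cancel image_iff)
  have Q1: "?Q - ?S \<subseteq> ?F (- int r)"
  proof
    fix x assume x: "x \<in> ?Q - ?S"
    then obtain j where j: "\<bar>(x - axis i 1) $ j\<bar> > int r"
      by (auto simp: S mem_cube_iff not_le)
    have xq: "\<bar>x $ j\<bar> \<le> int r" for j using x by (simp add: mem_cube_iff)
    have "x $ i = - int r"
      using j xq[of j] by (cases "j = i") (auto simp: axis_def)
    then show "x \<in> ?F (- int r)" using xq by simp
  qed
  have Q2: "?S - ?Q \<subseteq> ?F (int r + 1)"
  proof
    fix x assume x: "x \<in> ?S - ?Q"
    then obtain j where j: "\<bar>x $ j\<bar> > int r"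
      by (auto simp: mem_cube_iff not_le)
    have xq: "\<bar>(x - axis i 1) $ j\<bar> \<le> int r" for j
      using x S[of x] by (simp add: mem_cube_iff)
    have "x $ i = int r + 1"
      using j xq[of j] by (cases "j = i") (auto simp: axis_def)
    moreover have "\<bar>x $ j\<bar> \<le> int r" if "j \<noteq> i" for j
      using xq[of j] that by (simp add: axis_def)
    ultimately show "x \<in> ?F (int r + 1)" by simp
  qed
  have bd: "\<bar>sum k A\<bar> \<le> real (2 * r + 1) ^ (CARD('n) - 1) * B"
    if A: "A \<subseteq> ?F c" and c: "c = - int r \<or> c = int r + 1" for A c
  proof -
    have "\<bar>sum k A\<bar> \<le> (\<Sum>x\<in>A. \<bar>k x\<bar>)" by (rule sum_abs)
    also have "\<dots> \<le> real (card A) * B"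
      using A c by (intro sum_bounded_above B) auto
    also have "card A \<le> (2 * r + 1) ^ (CARD('n) - 1)"
      using card_mono[OF finite_cube_slice(1) A] finite_cube_slice(2)[of i c r] by linarith
    then have "real (card A) * B \<le> real (2 * r + 1) ^ (CARD('n) - 1) * B"
      using \<open>0 \<le> B\<close> by (intro mult_right_mono) (simp_all only: of_nat_le_iff flip: of_nat_power)
    finally show ?thesis .
  qed
  have "(\<Sum>x\<in>?Q. k x - k (x + axis i 1)) = sum k ?Q - sum k ?S"
    by (simp add: sum_subtractf sum.reindex)
  also have "\<dots> = sum k (?Q - ?S) - sum k (?S - ?Q)"
    using sum.Int_Diff[OF fin(1), of k ?S] sum.Int_Diff[OF fin(2), of k ?Q]
    by (simp add: Int_commute)
  finally show ?thesis using bd[OF Q1] bd[OF Q2] by simp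
qed

section \<open>Rigidity under nonnegative scalar curvature\<close>

lemma abs_weight_diff_le_Abs_grid:
  fixes x :: "int ^ 'n"
  assumes "i \<noteq> j"
  shows "\<bar>w x (x + axis i 1) - w (x + axis j 1) (x + axis j 1 + axis i 1)\<bar> \<le> Abs_grid w x"
    and "\<bar>w x (x + axis i 1) - w (x - axis j 1) (x - axis j 1 + axis i 1)\<bar> \<le> Abs_grid w x"
proof -
  let ?h = "\<lambda>(i, j). let ei = axis i 1; xp = x + axis j 1; xm = x - axis j 1 in
       \<bar>w x (x + ei) - w xp (xp + ei)\<bar> + \<bar>w x (x + ei) - w xm (xm + ei)\<bar> +
       \<bar>w x (x - ei) - w xp (xp - ei)\<bar> + \<bar>w x (x - ei) - w xm (xm - ei)\<bar>"
  have "?h (i, j) \<le> Abs_grid w x"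
    unfolding Abs_grid_def
    by (rule member_le_sum) (use assms in \<open>auto simp: Let_def\<close>)
  then show "\<bar>w x (x + axis i 1) - w (x + axis j 1) (x + axis j 1 + axis i 1)\<bar> \<le> Abs_grid w x"
    and "\<bar>w x (x + axis i 1) - w (x - axis j 1) (x - axis j 1 + axis i 1)\<bar> \<le> Abs_grid w x"
    unfolding Let_def prod.case by linarith+
qed

lemma standard_grid_if_nonneg_scalar_curvature:
  fixes w :: "int ^ 'n \<Rightarrow> int ^ 'n \<Rightarrow> real"
  assumes n: "CARD('n) \<ge> 2" and wg: "weighted_graph grid_adj w" and flat: "asymptotically_flat w"
    and R: "\<And>x. scalar_curvature grid_adj w x \<ge> 0"
  shows "standard_grid w"
proof -
  define q where "q = CARD('n) - 1"
  define g where "g i x = w x (x + axis i 1) - 1" for i x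
  \<comment> \<open>The shift by two steps makes \<open>k i x - k i (x + axis i 1)\<close> equal to
    the \<open>i\<close>-th term in \<open>scalar_curvature_le\<close>, with backward edges read as
    forward edges from their other endpoint.\<close>
  define k where "k i x = g i x - g i (x - axis i 1 - axis i 1)" for i x
  define D where "D x = (\<Sum>i\<in>UNIV. k i x - k i (x + axis i 1))" for x
  obtain p where p: "real CARD('n) < p"
    and w1: "\<And>\<epsilon>. \<epsilon> > 0 \<Longrightarrow> \<forall>\<^sub>F x in grid_infinity. \<forall>y. grid_adj x y \<longrightarrow> \<bar>w x y - 1\<bar> < \<epsilon>"
    and AO: "Abs_grid w \<in> O[grid_infinity](\<lambda>x. euclid_norm x powr (- p))"
    using flat by (auto simp: asymptotically_flat_def)
  have qp: "real q + 1 < p" using p n by (simp add: q_def of_nat_diff)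
  \<comment> \<open>Dimension at least 2 supplies a transverse direction for every edge.\<close>
  have other: "\<exists>j. j \<noteq> i" for i :: 'n
  proof (rule ccontr)
    assume "\<not> ?thesis"
    then have "UNIV = {i}" by auto
    then have "CARD('n) = 1" by (metis card_1_singleton_iff One_nat_def)
    then show False using n by simp
  qed
  have g_lim: "(g i \<longlongrightarrow> 0) grid_infinity" for i
  proof (rule tendstoI)
    fix e :: real assume "e > 0"
    from w1[OF this] show "\<forall>\<^sub>F x in grid_infinity. dist (g i x) 0 < e"
      by eventually_elim (auto simp: g_def grid_adj_iff)
  qed
  have g_step: "\<bar>g i x - g i (x + axis j 1)\<bar> \<le> Abs_grid w x"
    "\<bar>g i x - g i (x - axis j 1)\<bar> \<le> Abs_grid w x" if "i \<noteq> j" for i j x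
    using abs_weight_diff_le_Abs_grid[OF that, of w x] by (simp_all add: g_def)

  have Abs_le_D: "Abs_grid w x \<le> D x" for x
  proof -
    have sw: "w x (x - axis i 1) = w (x - axis i 1) x" for i x
      using weighted_graph_symD[OF wg, of x "x - axis i 1"] by (auto simp: grid_adj_iff)
    have "D x = (\<Sum>i\<in>UNIV. w x (x + axis i 1) - w (x + axis i 1) (x + axis i 1 + axis i 1) +
        w x (x - axis i 1) - w (x - axis i 1) (x - axis i 1 - axis i 1))"
      unfolding D_def k_def g_def sw by (intro sum.cong) simp_all
    then show ?thesis
      using scalar_curvature_le[OF wg, of x] R[of x] by simp
  qed
  have Abs_nonneg: "0 \<le> Abs_grid w x" for x
    using other g_step(1) by (meson abs_ge_zero order_trans)

  obtain C where C: "C > 0"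
    and "\<forall>\<^sub>F x in grid_infinity. norm (Abs_grid w x) \<le> C * norm (euclid_norm x powr (- p))"
    using AO by (elim landau_o.bigE)
  then obtain N where "\<And>x. N \<le> euclid_norm x \<Longrightarrow>
      norm (Abs_grid w x) \<le> C * norm (euclid_norm x powr (- p))"
    unfolding eventually_grid_infinity by blast
  then have N: "Abs_grid w x \<le> C * euclid_norm x powr (- p)" if "N \<le> euclid_norm x" for x
    using that Abs_nonneg[of x] by fastforce
  \<comment> \<open>Up to a constant this is the tail from \<open>m\<close> of a series that
    converges by \<open>qp\<close>, so it tends to 0.\<close>
  define T where "T m = C * 2 powr p * (\<Sum>k. real (k + m) powr (real q - p))" for m
  have decay: "real m ^ q * \<bar>g i x\<bar> \<le> T m"
    if m: "1 \<le> m" "N \<le> real m" "int m \<le> \<bar>x $ i\<bar>" for m i x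
  proof -
    obtain j where "i \<noteq> j" using other by metis
    then show ?thesis
      unfolding T_def
      by (intro transverse_decay[OF _ _ qp _ _ g_lim m] order_trans[OF g_step(1) N]
          order_trans[OF g_step(2) N]) (use C in auto)
  qed
  have "summable (\<lambda>k. real k powr (real q - p))"
    using qp by (simp add: summable_real_powr_iff)
  then have "(\<lambda>m. \<Sum>k. real (k + m) powr (real q - p)) \<longlonglongrightarrow> 0"
    unfolding LIMSEQ_iff using suminf_exist_split by fastforce
  then have T_lim: "T \<longlonglongrightarrow> 0"
    unfolding T_def by (rule tendsto_mult_right_zero)

  \<comment> \<open>The factors count the directions, the two end layers, the side length
    \<open>2 * m + 3\<close> bounded by \<open>5 * m\<close>, and the two values of \<open>g\<close>
    in \<open>k\<close>.\<close>
  define K where "K = real CARD('n) * (2 * 5 ^ q * 2)"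
  \<comment> \<open>On the end layers coordinate \<open>i\<close> is \<open>- (m + 1)\<close> or
    \<open>m + 2\<close>; the shift inside \<open>k\<close> moves it to \<open>- (m + 3)\<close> or
    \<open>m\<close>. Radius \<open>Suc m\<close> thus keeps all these points in the range of
    \<open>decay\<close>.\<close>
  have flux: "(\<Sum>x\<in>cube (Suc m). D x) \<le> K * T m" if m: "1 \<le> m" "N \<le> real m" for m
  proof -
    have m0: "real m ^ q > 0" using m by simp
    have T0: "0 \<le> T m"
      \<comment> \<open>Any point with a coordinate equal to \<open>m\<close> bounds
        \<open>T m\<close> below by a nonnegative number; \<open>undefined\<close> is an arbitrary
        index.\<close>
      using decay[OF m, of "axis undefined (int m)" undefined] m0
      by (smt (verit) axis_nth abs_ge_self mult_nonneg_nonneg abs_ge_zero)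
    have "\<bar>\<Sum>x\<in>cube (Suc m). k i x - k i (x + axis i 1)\<bar> \<le> 2 * 5 ^ q * 2 * T m" for i
    proof -
      have "\<bar>k i x\<bar> \<le> 2 * T m / real m ^ q"
        if x: "x $ i = - int (Suc m) \<or> x $ i = int (Suc m) + 1" for x
      proof -
        have far: "int m \<le> \<bar>x $ i\<bar>" "int m \<le> \<bar>(x - axis i 1 - axis i 1) $ i\<bar>"
          using x by (auto simp: axis_def)
        have "\<bar>g i x\<bar> \<le> T m / real m ^ q" "\<bar>g i (x - axis i 1 - axis i 1)\<bar> \<le> T m / real m ^ q"
          using decay[OF m far(1)] decay[OF m far(2)]
          unfolding pos_le_divide_eq[OF m0] by (simp_all only: mult.commute)
        then show ?thesis unfolding k_def by linarith
      qed
      then have "\<bar>\<Sum>x\<in>cube (Suc m). k i x - k i (x + axis i 1)\<bar>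
          \<le> 2 * real (2 * Suc m + 1) ^ q * (2 * T m / real m ^ q)"
        unfolding q_def by (rule abs_sum_cube_telescope_le) (use T0 in auto)
      also have "\<dots> \<le> 2 * (5 * real m) ^ q * (2 * T m / real m ^ q)"
        using T0 m by (intro mult_right_mono mult_left_mono power_mono) auto
      also have "\<dots> = 2 * 5 ^ q * 2 * T m"
        using m(1) by (simp add: power_mult_distrib)
      finally show ?thesis .
    qed
    then have "(\<Sum>x\<in>cube (Suc m). k i x - k i (x + axis i 1)) \<le> 2 * 5 ^ q * 2 * T m" for i
      using abs_le_D1 by blast
    then have "(\<Sum>i\<in>UNIV. \<Sum>x\<in>cube (Suc m). k i x - k i (x + axis i 1))
        \<le> real CARD('n) * (2 * 5 ^ q * 2 * T m)"
      by (rule sum_bounded_above)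
    then show ?thesis
      unfolding D_def K_def by (subst sum.swap) (simp only: mult.assoc)
  qed
  \<comment> \<open>All values of \<open>D\<close> are nonnegative, so a single one is at most the
    sum over any cube containing it, and these sums have bounds tending to 0.\<close>
  have D_le: "D x \<le> 0" for x
  proof -
    obtain r where r: "x \<in> cube r"
    proof
      show "x \<in> cube (nat (\<Sum>i\<in>UNIV. \<bar>x $ i\<bar>))"
        by (auto simp: mem_cube_iff sum_nonneg intro: member_le_sum)
    qed
    obtain M where M: "N \<le> real M" using real_arch_simple by blast
    have "D x \<le> K * T m" if "m \<ge> max 1 (max M r)" for m
    proof -
      have "D x \<le> (\<Sum>x\<in>cube (Suc m). D x)"
      proof (rule member_le_sum)
        have "int r \<le> int (Suc m)" using that by simp
        then show "x \<in> cube (Suc m)"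
          using r unfolding mem_cube_iff by (meson order_trans)
      qed (use Abs_le_D Abs_nonneg finite_cube in \<open>blast intro: order_trans\<close>)+
      also have "\<dots> \<le> K * T m" using that M by (intro flux) auto
      finally show ?thesis .
    qed
    moreover have "(\<lambda>m. K * T m) \<longlonglongrightarrow> 0"
      using T_lim by (rule tendsto_mult_right_zero)
    ultimately show ?thesis by (intro LIMSEQ_le_const) blast+
  qed

  have g0: "g i x = 0" for i x
  proof -
    obtain j where j: "i \<noteq> j" using other by metis
    have "Abs_grid w x \<le> 0" for x using Abs_le_D D_le order_trans by blast
    then have step: "g i (x + axis j 1) = g i x" for x
      using g_step(1)[OF j, of x] by (smt (verit))
    \<comment> \<open>Constancy along a transverse ray forces the limit value 0. The factor 1
      matches the form of \<open>filterlim_axis_grid_infinity\<close>.\<close>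
    have "g i (x + axis j (1 * int m)) = g i x" for m
    proof (induction m)
      case 0
      have "x + axis j (1 * int 0) = x" by (simp add: vec_eq_iff axis_def)
      then show ?case by (rule arg_cong)
    next
      case (Suc m)
      have "x + axis j (1 * int (Suc m)) = x + axis j (1 * int m) + axis j 1"
        by (simp add: vec_eq_iff axis_def)
      then show ?case using step Suc by metis
    qed
    moreover have "(\<lambda>m. g i (x + axis j (1 * int m))) \<longlonglongrightarrow> 0"
      by (intro filterlim_compose[OF g_lim] filterlim_axis_grid_infinity) simp
    ultimately have "(\<lambda>m::nat. g i x) \<longlonglongrightarrow> 0" by simp
    then show ?thesis by (simp add: LIMSEQ_const_iff)
  qed
  show ?thesis
    unfolding standard_grid_def
  proof (intro allI impI)
    fix x y :: "int ^ 'n" assume xy: "grid_adj x y"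
    then obtain i where "y = x + axis i 1 \<or> x = y + axis i 1"
      unfolding grid_adj_iff by (metis diff_add_cancel)
    then show "w x y = 1"
      using g0[of i x] g0[of i y] weighted_graph_symD[OF wg xy] by (auto simp: g_def)
  qed
qed

section \<open>The mass of the standard grid\<close>

text \<open>With unit weights both sums count edges. Prolonging each edge that leaves the cube
  straight on by one step is a bijection between the two edge sets, so the difference vanishes for
  every \<open>r\<close>.\<close>

lemma adm_difference_standard_grid:
  fixes w :: "int ^ 'n \<Rightarrow> int ^ 'n \<Rightarrow> real"
  assumes "standard_grid w"
  shows "adm_difference w r = 0"
proof -
  let ?E = "edges_between (cube r) (- cube r) :: ((int ^ 'n) \<times> (int ^ 'n)) set"
  let ?E' = "edges_between (outer_boundary (cube r)) (cube_surface (r + 2)) :: ((int ^ 'n) \<times> (int ^ 'n)) set"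
  have one: "(\<Sum>(x, y) \<in> edges_between A B. w x y) = real (card (edges_between A B))" for A B
  proof -
    have "(\<Sum>(x, y) \<in> edges_between A B. w x y) = (\<Sum>e \<in> edges_between A B. 1)"
      using assms by (intro sum.cong) (auto simp: edges_between_def standard_grid_def)
    then show ?thesis by simp
  qed
  have adjE: "\<exists>i s. \<bar>s\<bar> = 1 \<and> y = x + axis i s" if "grid_adj x y" for x y :: "int ^ 'n"
  proof -
    have "x - axis i 1 = x + axis i (- 1)" for i
      by (simp add: vec_eq_iff axis_def)
    then show ?thesis
      using that unfolding grid_adj_iff by (metis abs_1 abs_minus_cancel)
  qed
  have "bij_betw (\<lambda>(x, y). (y, y + y - x)) ?E ?E'"
  proof (rule bij_betw_byWitness[where f' = "\<lambda>(y, z). (y + y - z, y)"])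
    show "(\<lambda>(x, y). (y, y + y - x)) ` ?E \<subseteq> ?E'"
    proof clarify
      fix x y :: "int ^ 'n" assume "(x, y) \<in> ?E"
      then have x: "\<And>k. \<bar>x $ k\<bar> \<le> int r" and y: "y \<notin> cube r" and a: "grid_adj x y"
        by (auto simp: edges_between_def mem_cube_iff)
      obtain i s where s: "\<bar>s\<bar> = 1" "y = x + axis i s" using adjE[OF a] by blast
      obtain l where "\<bar>y $ l\<bar> > int r" using y by (auto simp: mem_cube_iff not_le)
      then have "\<bar>x $ i + s\<bar> > int r"
        using x[of l] s by (cases "l = i") (auto simp: axis_def)
      \<comment> \<open>A unit step that leaves the cube starts on a face and points outwards, so a
        second step ends at height \<open>r + 2\<close>.\<close>
      then have xi: "\<bar>x $ i + 2 * s\<bar> = int r + 2"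
        using x[of i] s(1) by linarith
      have z: "y + y - x = x + axis i (2 * s)"
        using s by (simp add: vec_eq_iff axis_def)
      have "\<bar>(x + axis i (2 * s)) $ k\<bar> \<le> int (r + 2)" for k
        using x[of k] xi by (cases "k = i") (auto simp: axis_def)
      moreover have "\<bar>(x + axis i (2 * s)) $ i\<bar> = int (r + 2)"
        using xi by (simp add: axis_def)
      ultimately have "y + y - x \<in> cube_surface (r + 2)"
        unfolding z mem_cube_surface_iff by blast
      moreover have "grid_adj y (y + y - x)" "grid_adj y x"
        using a by (simp_all add: grid_adj_def abs_minus_commute)
      ultimately show "(y, y + y - x) \<in> ?E'"
        using x y by (auto simp: edges_between_def outer_boundary_def mem_cube_iff)
    qed
    show "(\<lambda>(y, z). (y + y - z, y)) ` ?E' \<subseteq> ?E"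
    proof clarify
      fix y z :: "int ^ 'n" assume "(y, z) \<in> ?E'"
      then obtain x where y: "y \<notin> cube r" and yx: "grid_adj y x" and x: "\<And>k. \<bar>x $ k\<bar> \<le> int r"
        and z: "z \<in> cube_surface (r + 2)" and yz: "grid_adj y z"
        by (auto simp: edges_between_def outer_boundary_def mem_cube_iff)
      obtain i s where s: "\<bar>s\<bar> = 1" "x = y + axis i s" using adjE[OF yx] by blast
      obtain j t where t: "\<bar>t\<bar> = 1" "z = y + axis j t" using adjE[OF yz] by blast
      obtain l where l: "\<bar>z $ l\<bar> = int r + 2" using z by (auto simp: mem_cube_surface_iff add.commute)
      have yk: "\<bar>y $ k\<bar> \<le> int r" if "k \<noteq> i" for k
        using x[of k] s(2) that by (simp add: axis_def)
      have yi: "\<bar>y $ i + s\<bar> \<le> int r"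
        using x[of i] s(2) by (simp add: axis_def)
      \<comment> \<open>The coordinates of \<open>y\<close> other than \<open>i\<close> are at most
        \<open>r\<close> in size, and coordinate \<open>i\<close> is at most \<open>r + 1\<close>.
        One step can therefore reach size \<open>r + 2\<close> only in direction \<open>i\<close>,
        which makes the edge to \<open>z\<close> collinear with the edge to
        \<open>x\<close>.\<close>
      have li: "l = i"
        using yk[of l] l t by (cases "l = i"; cases "l = j") (auto simp: axis_def)
      have ji: "j = i"
        using yi l t s(1) unfolding li by (cases "j = i") (auto simp: axis_def)
      have zi: "\<bar>y $ i + t\<bar> = int r + 2"
        using l t(2) unfolding li ji by (simp add: axis_def)
      have "\<bar>(y + y - z) $ k\<bar> \<le> int r" for k
      proof (cases "k = i")
        case True
        have "\<bar>y $ i - t\<bar> \<le> int r" using yi zi s(1) t(1) by linarith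
        then show ?thesis using True t(2) ji by (simp add: axis_def)
      next
        case False
        then show ?thesis using yk[of k] t(2) ji by (simp add: axis_def)
      qed
      moreover have "grid_adj (y + y - z) y"
        using yz by (simp add: grid_adj_def abs_minus_commute)
      ultimately show "(y + y - z, y) \<in> ?E"
        using y by (simp add: edges_between_def mem_cube_iff)
    qed
  qed auto
  then have "card ?E = card ?E'" by (rule bij_betw_same_card)
  then show ?thesis by (simp add: adm_difference_def one)
qed

theorem theorem1p7:
  fixes w :: "int ^ 'n \<Rightarrow> int ^ 'n \<Rightarrow> real"
  assumes "CARD('n) \<ge> 2"
    and "weighted_graph grid_adj w"
    and "asymptotically_flat w"
    and "\<And>x. scalar_curvature grid_adj w x \<ge> 0"
  shows "convergent (adm_difference w) \<and> adm_mass w \<ge> 0 \<and>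
         (adm_mass w = 0 \<longleftrightarrow> standard_grid w)"
proof -
  \<comment> \<open>The equivalence holds because both of its sides are true, and the sequence
    converges because it is constant.\<close>
  have std: "standard_grid w"
    using assms by (rule standard_grid_if_nonneg_scalar_curvature)
  then have z: "adm_difference w = (\<lambda>_. 0)"
    by (auto simp: adm_difference_standard_grid)
  then have "adm_mass w = 0"
    by (simp add: adm_mass_def)
  then show ?thesis
    using std z by (simp add: convergent_const)
qed

end
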